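(* Let $s$ be a positive integer. Then there exist pseudosignatures on arbitrarily large square grids which are satisfied by exactly $s$ pseudocycles; that is, for every positive integer $n_0$ there exist an integer $n \ge n_0$ and a pseudocycle $C$ in the $n \times n$ grid such that exactly $s$ pseudocycles in the $n \times n$ grid (including $C$ itself) have the same pseudosignature as $C$.
   Context: The $n \times n$ grid is the plane graph whose vertices are the integer points $(x, y)$ with $1 \le x \le n$ and $1 \le y \le n$ and whose edges are the unit segments between these points; its finite faces are the unit square cells. A pseudocycle in a graph is the union of some number of pairwise (vertex-)disjoint cycles in it; so it is a $2$-regular subgraph, not necessarily connected. The pseudosignature of a pseudocycle $C$ on the grid is the function assigning to each cell the number of edges of that cell which belong to $C$; a pseudocycle satisfies a pseudosignature when its own pseudosignature equals it. *)

theory Defs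
  imports Main "HOL-Library.FuncSet"
begin

(* Edges are two-element vertex sets.  Cycles and pseudocycles are represented by
   their edge sets: they have no isolated vertices, so the vertex set is the union
   of the edges. *)

definition cycle_edges :: "'a list \<Rightarrow> 'a set set" where
  "cycle_edges vs = {{vs ! i, vs ! (Suc i mod length vs)} | i. i < length vs}"

definition is_cycle :: "'a set set \<Rightarrow> 'a set set \<Rightarrow> bool" where
  "is_cycle E C \<longleftrightarrow>
     (\<exists>vs. 3 \<le> length vs \<and> distinct vs \<and> C = cycle_edges vs) \<and> C \<subseteq> E"

(* At least one cycle is required.  On a grid, the empty edge set is the only one
   whose number of edges is 0 around every cell (provided there are cells), so
   excluding it does not affect how many pseudocycles share the pseudosignature
   of a nonempty one. *)

definition pseudocycle :: "'a set set \<Rightarrow> 'a set set \<Rightarrow> bool" where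
  "pseudocycle E P \<longleftrightarrow>
     (\<exists>Cs. finite Cs \<and> Cs \<noteq> {} \<and> (\<forall>C\<in>Cs. is_cycle E C) \<and>
           pairwise (\<lambda>C D. \<Union>C \<inter> \<Union>D = {}) Cs \<and> P = \<Union>Cs)"

definition grid_vertices :: "nat \<Rightarrow> (int \<times> int) set" where
  "grid_vertices n = {1..int n} \<times> {1..int n}"

definition grid_edges :: "nat \<Rightarrow> (int \<times> int) set set" where
  "grid_edges n = {{(x, y), (x', y')} | x y x' y'.
     (x, y) \<in> grid_vertices n \<and> (x', y') \<in> grid_vertices n \<and> \<bar>x - x'\<bar> + \<bar>y - y'\<bar> = 1}"

(* A cell is named by its corner with the smallest coordinates. *)

definition grid_cells :: "nat \<Rightarrow> (int \<times> int) set" where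
  "grid_cells n = {1..<int n} \<times> {1..<int n}"

fun cell_edges :: "int \<times> int \<Rightarrow> (int \<times> int) set set" where
  "cell_edges (x, y) =
     {{(x, y), (x + 1, y)}, {(x, y + 1), (x + 1, y + 1)},
      {(x, y), (x, y + 1)}, {(x + 1, y), (x + 1, y + 1)}}"

definition pseudosignature :: "nat \<Rightarrow> (int \<times> int) set set \<Rightarrow> int \<times> int \<Rightarrow> nat" where
  "pseudosignature n P = (\<lambda>c\<in>grid_cells n. card (cell_edges c \<inter> P))"

definition satisfies ::
    "nat \<Rightarrow> (int \<times> int) set set \<Rightarrow> (int \<times> int \<Rightarrow> nat) \<Rightarrow> bool" where
  "satisfies n P \<sigma> \<longleftrightarrow> pseudocycle (grid_edges n) P \<and> pseudosignature n P = \<sigma>"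

end

theory Submission
  imports Defs
begin

text \<open>
  Pseudocycles on the grid are the outlines of the sets of cells without a checkerboard \<open>2 \<times> 2\<close> block.
  Take a \<open>k \<times> k\<close> board of cells, \<open>k = 2m + 1\<close>, and a comb: all cells in odd columns, except those
  in the bottom row with \<open>x \<le> 2t\<close>. For even \<open>j\<close> let \<open>R\<^sub>j\<close> be the cells with \<open>x + y\<close> odd in the tilted
  rectangle with corners \<open>(j, 1)\<close>, \<open>(1, j)\<close>, \<open>(k, k + 1 - j)\<close>, \<open>(k + 1 - j, k)\<close>. Flipping \<open>R\<^sub>j\<close>
  turns the vertical stripes inside the rectangle into horizontal ones and preserves the signature as long as
  \<open>(j, 1)\<close> is away from the removed cells, i.e. \<open>2t < j \<le> 2m\<close>.

  Conversely, let \<open>D\<close> be the set of cells in which a solution differs from the comb. A signature and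
  the first row determine all other rows, so it suffices to bound the possible first rows of \<open>D\<close>. The
  signature forces every cell to have an even number of neighbours in \<open>D\<close>, which makes \<open>D\<close> symmetric
  along the bottom row and left column; together with the values at the border this excludes cells
  \<open>(x, 1)\<close> of \<open>D\<close> with \<open>x\<close> odd or \<open>x \<le> 2t\<close>. Hence all of \<open>D\<close> has \<open>x + y\<close> odd, each cell with
  \<open>x + y\<close> even has as many horizontal as vertical neighbours in \<open>D\<close>, and this discrete wave equation
  propagates the number of cells of \<open>D\<close> in the bottom row to the single cell \<open>(m, m + 1)\<close>. So that
  number is at most 1, and the \<open>m - t + 1\<close> solutions found are all of them.
\<close>

section \<open>Edge sets with all degrees 0 or 2\<close>

lemma cycle_edges_degree:
  assumes L: "3 \<le> length vs" and dist: "distinct vs"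
  shows "card {e \<in> cycle_edges vs. v \<in> e} = (if v \<in> set vs then 2 else 0)"
proof (cases "v \<in> set vs")
  case False
  have "{e \<in> cycle_edges vs. v \<in> e} = {}"
  proof -
    have "vs ! (Suc i mod length vs) \<in> set vs" for i
      using L by (intro nth_mem) (auto intro: mod_less_divisor)
    then show ?thesis using False by (auto simp: cycle_edges_def)
  qed
  then show ?thesis using False by (simp only: card.empty if_False)
next
  case True
  let ?L = "length vs"
  obtain i where i: "i < ?L" "v = vs ! i" using True by (metis in_set_conv_nth)
  \<comment> \<open>The cyclic predecessor of \<open>i\<close>. The edges at \<open>v\<close> lead
    to its successor and its predecessor, which differ because the length is at least 3.\<close>
  define j where "j = (if i = 0 then ?L - 1 else i - 1)"
  have j: "j < ?L" "Suc j mod ?L = i"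
    and uniq: "\<And>l. l < ?L \<Longrightarrow> Suc l mod ?L = i \<Longrightarrow> l = j"
    using i L unfolding j_def by (auto simp: mod_Suc split: if_splits)
  have neq: "j \<noteq> i" "j \<noteq> Suc i mod ?L" "i \<noteq> Suc i mod ?L" "Suc i mod ?L < ?L"
    using i L unfolding j_def by (auto simp: mod_Suc split: if_splits)
  have eq: "{e \<in> cycle_edges vs. v \<in> e} = {{vs ! i, vs ! (Suc i mod ?L)}, {vs ! j, vs ! i}}"
    (is "?A = ?B")
  proof
    show "?A \<subseteq> ?B"
    proof
      fix e assume "e \<in> ?A"
      then obtain l where l: "l < ?L" "e = {vs ! l, vs ! (Suc l mod ?L)}" "v \<in> e"
        by (auto simp: cycle_edges_def)
      have "Suc l mod ?L < ?L" using L by (auto intro: mod_less_divisor)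
      then have "l = i \<or> Suc l mod ?L = i"
        using l i dist by (auto simp: nth_eq_iff_index_eq)
      then show "e \<in> ?B" using l uniq by auto
    qed
    show "?B \<subseteq> ?A" using i j by (auto simp: cycle_edges_def)
  qed
  have "vs ! j \<noteq> vs ! i" "vs ! j \<noteq> vs ! (Suc i mod ?L)" "vs ! i \<noteq> vs ! (Suc i mod ?L)"
    using neq i j dist by (auto simp: nth_eq_iff_index_eq)
  then have "card ?B = 2" by (auto simp: doubleton_eq_iff)
  then show ?thesis using eq True by simp
qed

lemma Union_cycle_edges:
  assumes "vs \<noteq> []"
  shows "\<Union>(cycle_edges vs) = set vs"
proof
  have "vs ! (Suc i mod length vs) \<in> set vs" for i
    using assms by (intro nth_mem) (auto intro: mod_less_divisor)
  then show "\<Union>(cycle_edges vs) \<subseteq> set vs" by (auto simp: cycle_edges_def)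
  show "set vs \<subseteq> \<Union>(cycle_edges vs)"
    unfolding cycle_edges_def by (auto simp: in_set_conv_nth) blast
qed

lemma is_cycle_degree:
  assumes "is_cycle E C"
  shows "card {e \<in> C. v \<in> e} = (if v \<in> \<Union>C then 2 else 0)"
proof -
  obtain vs where vs: "3 \<le> length vs" "distinct vs" "C = cycle_edges vs"
    using assms by (auto simp: is_cycle_def)
  then have "vs \<noteq> []" by auto
  then show ?thesis using cycle_edges_degree[OF vs(1,2), of v] Union_cycle_edges vs(3) by metis
qed

text \<open>Even degrees are what makes inside and outside consistent when cells are recovered from
  an edge set.\<close>

lemma pseudocycle_even_degree:
  assumes "pseudocycle E P"
  shows "even (card {e \<in> P. v \<in> e})"
proof -
  obtain Cs where Cs: "\<And>C. C \<in> Cs \<Longrightarrow> is_cycle E C"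
    "pairwise (\<lambda>C D. \<Union>C \<inter> \<Union>D = {}) Cs" "P = \<Union>Cs"
    using assms by (auto simp: pseudocycle_def)
  show ?thesis
  proof (cases "\<exists>C\<in>Cs. v \<in> \<Union>C")
    case True
    then obtain C where C: "C \<in> Cs" "v \<in> \<Union>C" by blast
    have "D = C" if "D \<in> Cs" "v \<in> \<Union>D" for D
      using Cs(2) C that unfolding pairwise_def by blast
    then have "{e \<in> P. v \<in> e} = {e \<in> C. v \<in> e}" using C Cs(3) by blast
    then show ?thesis using is_cycle_degree[OF Cs(1)[OF C(1)], of v] by auto
  next
    case False
    then have "{e \<in> P. v \<in> e} = {}" using Cs(3) by blast
    then show ?thesis by (metis card.empty even_zero)
  qed
qed

lemma pseudocycle_subset:
  "pseudocycle E P \<Longrightarrow> P \<subseteq> E"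
  by (auto simp: pseudocycle_def is_cycle_def)

text \<open>A longest path in \<open>P\<close> closes up to a cycle: both edges at its first vertex lead back into the
  path, and only its last vertex still has an edge to spare.\<close>

lemma obtain_cycle_of_degree_2:
  assumes fin: "finite P" and card2: "\<And>e. e \<in> P \<Longrightarrow> card e = 2"
    and deg: "\<And>v. card {e \<in> P. v \<in> e} \<in> {0, 2}" and ne: "P \<noteq> {}"
  obtains vs where "3 \<le> length vs" "distinct vs" "cycle_edges vs \<subseteq> P"
proof -
  define path where
    "path vs \<longleftrightarrow> 2 \<le> length vs \<and> distinct vs \<and> (\<forall>i. Suc i < length vs \<longrightarrow> {vs ! i, vs ! Suc i} \<in> P)"
    for vs :: "'a list"
  have finV: "finite (\<Union>P)"
    using fin card2 by (metis card.infinite finite_Union zero_neq_numeral)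
  have pathV: "set vs \<subseteq> \<Union>P" if "path vs" for vs
  proof
    fix v assume "v \<in> set vs"
    then obtain i where i: "i < length vs" "v = vs ! i" by (metis in_set_conv_nth)
    show "v \<in> \<Union>P"
    proof (cases "Suc i < length vs")
      case True then show ?thesis using that i by (auto simp: path_def)
    next
      case False
      with i that have "Suc (i - 1) < length vs" "Suc (i - 1) = i" by (auto simp: path_def)
      then show ?thesis using that i unfolding path_def by (metis UnionI insertCI)
    qed
  qed
  have bound: "length vs < Suc (card (\<Union>P))" if "path vs" for vs
  proof -
    have "card (set vs) \<le> card (\<Union>P)" by (intro card_mono finV pathV that)
    then show ?thesis using that distinct_card[of vs] by (auto simp: path_def)
  qed
  obtain e where "e \<in> P" using ne by blast
  then obtain a b where "e = {a, b}" "a \<noteq> b" using card2 card_2_iff by metis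
  then have "path [a, b]" using \<open>e \<in> P\<close> by (auto simp: path_def)
  then obtain vs where vs: "path vs" and maxi: "\<And>ws. path ws \<Longrightarrow> length ws \<le> length vs"
    using ex_has_greatest_nat[of path "[a,b]" length "Suc (card (\<Union>P))"] bound
    by (metis order_less_imp_le)
  let ?L = "length vs"
  have L2: "2 \<le> ?L" and dist: "distinct vs"
    and edge: "\<And>i. Suc i < ?L \<Longrightarrow> {vs ! i, vs ! Suc i} \<in> P"
    using vs by (auto simp: path_def)
  have e0: "{vs ! 0, vs ! 1} \<in> P" using edge[of 0] L2 by simp
  have fin_at: "finite {e \<in> P. v \<in> e}" for v using fin by simp
  have "{vs ! 0, vs ! 1} \<in> {e \<in> P. vs ! 0 \<in> e}" using e0 by simp
  then have "card {e \<in> P. vs ! 0 \<in> e} \<noteq> 0" using fin_at by (metis card_eq_0_iff empty_iff)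
  then have "card {e \<in> P. vs ! 0 \<in> e} = 2" using deg[of "vs ! 0"] by simp
  moreover have "card {{vs ! 0, vs ! 1}} = 1" by simp
  ultimately have "\<not> {e \<in> P. vs ! 0 \<in> e} \<subseteq> {{vs ! 0, vs ! 1}}"
    using card_mono[of "{{vs ! 0, vs ! 1}}" "{e \<in> P. vs ! 0 \<in> e}"] by force
  then obtain e' where e': "e' \<in> P" "vs ! 0 \<in> e'" "e' \<noteq> {vs ! 0, vs ! 1}" by blast
  then obtain c where c: "e' = {vs ! 0, c}" "c \<noteq> vs ! 0" "c \<noteq> vs ! 1"
    using card2[OF e'(1)] by (auto simp: card_2_iff)
  have "c \<in> set vs"
  proof (rule ccontr)
    assume "c \<notin> set vs"
    then have "path (c # vs)"
      using vs e'(1) c unfolding path_def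
      by (auto simp: nth_Cons insert_commute split: nat.splits)
    then show False using maxi by fastforce
  qed
  then obtain i where i: "i < ?L" "c = vs ! i" by (metis in_set_conv_nth)
  have i2: "2 \<le> i" using c i by (metis One_nat_def less_2_cases linorder_not_le numeral_2_eq_2)
  have last: "Suc i = ?L"
  proof (rule ccontr)
    assume "Suc i \<noteq> ?L"
    then have Si: "Suc i < ?L" using i by simp
    let ?T = "{{vs ! 0, vs ! i}, {vs ! (i - 1), vs ! i}, {vs ! i, vs ! Suc i}}"
    have "{vs ! (i - 1), vs ! i} \<in> P" using edge[of "i - 1"] i i2 by simp
    then have "?T \<subseteq> {e \<in> P. vs ! i \<in> e}" using edge[OF Si] e' c i by auto
    then have "card ?T \<le> card {e \<in> P. vs ! i \<in> e}" by (intro card_mono fin_at)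
    moreover have ne: "vs ! p \<noteq> vs ! q" if "p < q" "q < ?L" for p q
      using dist that by (simp add: nth_eq_iff_index_eq)
    have "vs ! 0 \<noteq> vs ! i" "vs ! 0 \<noteq> vs ! (i - 1)" "vs ! 0 \<noteq> vs ! Suc i"
      "vs ! (i - 1) \<noteq> vs ! i" "vs ! (i - 1) \<noteq> vs ! Suc i" "vs ! i \<noteq> vs ! Suc i"
      by (rule ne; use i2 Si in linarith)+
    then have "card ?T = 3" by (auto simp: doubleton_eq_iff card_insert_if)
    ultimately show False using deg[of "vs ! i"] by auto
  qed
  have "cycle_edges vs \<subseteq> P"
  proof
    fix e assume "e \<in> cycle_edges vs"
    then obtain l where l: "l < ?L" "e = {vs ! l, vs ! (Suc l mod ?L)}"
      by (auto simp: cycle_edges_def)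
    show "e \<in> P"
    proof (cases "Suc l = ?L")
      case True
      then have "l = i" using last by simp
      then have "e = e'" using l(2) c(1) i(2) True by (simp add: insert_commute)
      then show ?thesis using e'(1) by simp
    next
      case False
      then show ?thesis using l edge by (simp add: mod_less)
    qed
  qed
  then show thesis using that[of vs] dist i2 last by auto
qed

text \<open>Cycles are peeled off one at a time. A cycle inside \<open>P\<close> uses up degree 2 at
  each of its vertices, so the remaining edges avoid these vertices and still have all degrees 0 or
  2.\<close>

lemma pseudocycle_if_degree_0_2:
  assumes "finite P" "P \<noteq> {}" "P \<subseteq> E" "\<And>e. e \<in> E \<Longrightarrow> card e = 2"
    and "\<And>v. card {e \<in> P. v \<in> e} \<in> {0, 2}"
  shows "pseudocycle E P"
  using assms(1,2,3,5)
proof (induction "card P" arbitrary: P rule: less_induct)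
  case less
  obtain vs where vs: "3 \<le> length vs" "distinct vs" "cycle_edges vs \<subseteq> P"
    by (rule obtain_cycle_of_degree_2[OF less.prems(1) _ less.prems(4,2)])
      (use less.prems(3) assms(4) in auto)
  define C where "C = cycle_edges vs"
  have CP: "C \<subseteq> P" and finC: "finite C"
    using vs less.prems(1) finite_subset unfolding C_def by auto
  have C: "is_cycle E C" using vs less.prems(3) unfolding C_def is_cycle_def by blast
  have off_C: "v \<notin> \<Union>(P - C)" if "v \<in> \<Union>C" for v
  proof -
    have "card {e \<in> C. v \<in> e} = 2" using is_cycle_degree[OF C, of v] that by auto
    moreover have "{e \<in> C. v \<in> e} \<subseteq> {e \<in> P. v \<in> e}" using CP by blast
    moreover have "card {e \<in> P. v \<in> e} \<le> 2" using less.prems(4)[of v] by auto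
    ultimately have "{e \<in> C. v \<in> e} = {e \<in> P. v \<in> e}"
      using less.prems(1) by (intro card_seteq) auto
    then show ?thesis by blast
  qed
  show ?case
  proof (cases "P = C")
    case True
    then show ?thesis using C unfolding pseudocycle_def
      by (intro exI[of _ "{C}"]) auto
  next
    case False
    have deg: "card {e \<in> P - C. v \<in> e} \<in> {0, 2}" for v
    proof (cases "v \<in> \<Union>C")
      case True
      then have "{e \<in> P - C. v \<in> e} = {}" using off_C by blast
      then show ?thesis by (metis card.empty insertI1)
    next
      case False
      then have "{e \<in> P - C. v \<in> e} = {e \<in> P. v \<in> e}" by blast
      then show ?thesis using less.prems(4) by simp
    qed
    have "C \<noteq> {}" using vs unfolding C_def cycle_edges_def by force
    then have "card (P - C) < card P"
      using CP less.prems(1) by (intro psubset_card_mono) auto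
    moreover have "P - C \<noteq> {}" using False CP by blast
    ultimately have "pseudocycle E (P - C)"
      using less.hyps less.prems(1,3) deg by blast
    then obtain Cs where Cs: "finite Cs" "\<forall>D\<in>Cs. is_cycle E D"
      "pairwise (\<lambda>C D. \<Union>C \<inter> \<Union>D = {}) Cs" "P - C = \<Union>Cs"
      by (auto simp: pseudocycle_def)
    have "\<Union>C \<inter> \<Union>D = {}" if "D \<in> Cs" for D using off_C Cs(4) that by blast
    then have "pairwise (\<lambda>C D. \<Union>C \<inter> \<Union>D = {}) (insert C Cs)"
      using Cs(3) by (simp add: pairwise_insert Int_commute)
    moreover have "P = \<Union>(insert C Cs)" using Cs(4) CP by auto
    ultimately show ?thesis using Cs(1,2) C unfolding pseudocycle_def
      by (intro exI[of _ "insert C Cs"]) auto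
  qed
qed

section \<open>Outlines of sets of cells\<close>

definition hedge :: "int \<Rightarrow> int \<Rightarrow> (int \<times> int) set" where
  "hedge x y = {(x, y), (x + 1, y)}"

definition vedge :: "int \<Rightarrow> int \<Rightarrow> (int \<times> int) set" where
  "vedge x y = {(x, y), (x, y + 1)}"

lemma edge_eq_simps [simp]:
  "hedge x y = hedge x' y' \<longleftrightarrow> x = x' \<and> y = y'"
  "vedge x y = vedge x' y' \<longleftrightarrow> x = x' \<and> y = y'"
  "hedge x y \<noteq> vedge x' y'" "vedge x' y' \<noteq> hedge x y"
  by (auto simp: hedge_def vedge_def doubleton_eq_iff)

lemma grid_edges_eq:
  "grid_edges n = {hedge x y | x y. 1 \<le> x \<and> x < int n \<and> 1 \<le> y \<and> y \<le> int n} \<union>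
     {vedge x y | x y. 1 \<le> x \<and> x \<le> int n \<and> 1 \<le> y \<and> y < int n}" (is "_ = ?R")
proof
  show "grid_edges n \<subseteq> ?R"
  proof
    fix e assume "e \<in> grid_edges n"
    then obtain x y x' y' where e: "e = {(x, y), (x', y')}" "(x, y) \<in> grid_vertices n"
      "(x', y') \<in> grid_vertices n" "\<bar>x - x'\<bar> + \<bar>y - y'\<bar> = 1"
      by (auto simp: grid_edges_def)
    then consider "x' = x + 1" "y' = y" | "x = x' + 1" "y' = y" | "x' = x" "y' = y + 1"
      | "x' = x" "y = y' + 1" by linarith
    then show "e \<in> ?R"
    proof cases
      case 1
      then have "e = hedge x y" using e by (auto simp: hedge_def)
      then show ?thesis using e 1 by (auto simp: grid_vertices_def)
    next
      case 2
      then have "e = hedge x' y" using e by (auto simp: hedge_def)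
      then show ?thesis using e 2 by (auto simp: grid_vertices_def)
    next
      case 3
      then have "e = vedge x y" using e by (auto simp: vedge_def)
      then show ?thesis using e 3 by (auto simp: grid_vertices_def)
    next
      case 4
      then have "e = vedge x y'" using e by (auto simp: vedge_def)
      then show ?thesis using e 4 by (auto simp: grid_vertices_def)
    qed
  qed
  have "hedge x y \<in> grid_edges n" if "1 \<le> x" "x < int n" "1 \<le> y" "y \<le> int n" for x y
    unfolding grid_edges_def mem_Collect_eq hedge_def
    by (intro exI[of _ x] exI[of _ y] exI[of _ "x + 1"] conjI refl)
      (use that in \<open>auto simp: grid_vertices_def\<close>)
  moreover have "vedge x y \<in> grid_edges n" if "1 \<le> x" "x \<le> int n" "1 \<le> y" "y < int n" for x y
    unfolding grid_edges_def mem_Collect_eq vedge_def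
    by (rule exI[of _ x], rule exI[of _ y], rule exI[of _ x], rule exI[of _ "y + 1"])
      (use that in \<open>auto simp: grid_vertices_def\<close>)
  ultimately show "?R \<subseteq> grid_edges n" by blast
qed

lemma hedge_grid_iff: "hedge x y \<in> grid_edges n \<longleftrightarrow> 1 \<le> x \<and> x < int n \<and> 1 \<le> y \<and> y \<le> int n"
  and vedge_grid_iff: "vedge x y \<in> grid_edges n \<longleftrightarrow> 1 \<le> x \<and> x \<le> int n \<and> 1 \<le> y \<and> y < int n"
  by (auto simp: grid_edges_eq)

lemma card_grid_edge: "e \<in> grid_edges n \<Longrightarrow> card e = 2"
  by (auto simp: grid_edges_eq hedge_def vedge_def)

lemma finite_grid_edges: "finite (grid_edges n)"
proof -
  have "grid_edges n \<subseteq> Pow (grid_vertices n)" by (auto simp: grid_edges_def)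
  then show ?thesis by (rule finite_subset) (simp add: grid_vertices_def)
qed

lemma card_Int_4:
  assumes "distinct [a, b, c, d]"
  shows "card ({a, b, c, d} \<inter> P) =
    of_bool (a \<in> P) + of_bool (b \<in> P) + of_bool (c \<in> P) + of_bool (d \<in> P)"
  using assms by (auto simp: Int_insert_left)

lemma grid_degree:
  assumes "P \<subseteq> grid_edges n"
  shows "card {e \<in> P. (x, y) \<in> e} = of_bool (hedge x y \<in> P) + of_bool (hedge (x - 1) y \<in> P) +
    of_bool (vedge x y \<in> P) + of_bool (vedge x (y - 1) \<in> P)"
proof -
  have "{e \<in> P. (x, y) \<in> e} = {hedge x y, hedge (x - 1) y, vedge x y, vedge x (y - 1)} \<inter> P"
    (is "?A = ?B")
  proof
    show "?A \<subseteq> ?B"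
    proof
      fix e assume e: "e \<in> ?A"
      then obtain a b where "e = hedge a b \<or> e = vedge a b"
        using assms unfolding grid_edges_eq by blast
      moreover have "hedge a b \<in> {hedge x y, hedge (x - 1) y}" if "(x, y) \<in> hedge a b"
        using that by (auto simp: hedge_def)
      moreover have "vedge a b \<in> {vedge x y, vedge x (y - 1)}" if "(x, y) \<in> vedge a b"
        using that by (auto simp: vedge_def)
      ultimately show "e \<in> ?B" using e by blast
    qed
    show "?B \<subseteq> ?A" by (auto simp: hedge_def vedge_def)
  qed
  then show ?thesis by (simp only:) (subst card_Int_4, auto)
qed

text \<open>\<open>F\<close> lives on the whole integer plane, cells being named by their lower left
  corner. Edges on the boundary of the grid then need no special treatment: they separate a cell
  from an empty one outside.\<close>

definition outline :: "(int \<Rightarrow> int \<Rightarrow> bool) \<Rightarrow> (int \<times> int) set set" where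
  "outline F = {hedge x y | x y. F x y \<noteq> F x (y - 1)} \<union> {vedge x y | x y. F x y \<noteq> F (x - 1) y}"

lemma hedge_outline_iff: "hedge x y \<in> outline F \<longleftrightarrow> F x y \<noteq> F x (y - 1)"
  and vedge_outline_iff: "vedge x y \<in> outline F \<longleftrightarrow> F x y \<noteq> F (x - 1) y"
  by (auto simp: outline_def)

definition region :: "nat \<Rightarrow> (int \<Rightarrow> int \<Rightarrow> bool) \<Rightarrow> bool" where
  "region n F \<longleftrightarrow> (\<forall>x y. F x y \<longrightarrow> (x, y) \<in> grid_cells n)"

lemma region_outside:
  "region n F \<Longrightarrow> x < 1 \<or> int n \<le> x \<or> y < 1 \<or> int n \<le> y \<Longrightarrow> \<not> F x y"
  by (force simp: region_def grid_cells_def)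

lemma outline_subset:
  assumes "region n F"
  shows "outline F \<subseteq> grid_edges n"
proof -
  have "hedge x y \<in> grid_edges n" if "F x y \<noteq> F x (y - 1)" for x y
    using that region_outside[OF assms, of x y] region_outside[OF assms, of x "y - 1"]
    by (force simp: hedge_grid_iff)
  moreover have "vedge x y \<in> grid_edges n" if "F x y \<noteq> F (x - 1) y" for x y
    using that region_outside[OF assms, of x y] region_outside[OF assms, of "x - 1" y]
    by (force simp: vedge_grid_iff)
  ultimately show ?thesis by (auto simp: outline_def)
qed

text \<open>Going up a column from below the grid, where both regions are empty, the horizontal
  edges tell at each step whether membership changes.\<close>

lemma outline_eqD:
  assumes "region n F" "region n G" "outline F = outline G"
  shows "F = G"
proof -
  have "F x (int k) = G x (int k)" for x k
  proof (induction k)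
    case 0
    then show ?case using region_outside[OF assms(1)] region_outside[OF assms(2)] by simp
  next
    case (Suc k)
    have "(F x (int (Suc k)) \<noteq> F x (int k)) = (G x (int (Suc k)) \<noteq> G x (int k))"
      using hedge_outline_iff[of x "int (Suc k)" F] hedge_outline_iff[of x "int (Suc k)" G] assms(3)
      by simp
    then show ?case using Suc by blast
  qed
  then have "F x y = G x y" if "0 \<le> y" for x y using that by (metis nonneg_int_cases)
  moreover have "F x y = G x y" if "y < 0" for x y
    using that region_outside[OF assms(1), of x y] region_outside[OF assms(2), of x y] by simp
  ultimately have "F x y = G x y" for x y by (metis not_le)
  then show ?thesis by blast
qed

text \<open>The parity of the number of horizontal edges below a cell decides whether it lies inside.\<close>

lemma pseudocycle_outline:
  assumes "pseudocycle (grid_edges n) P"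
  obtains F where "region n F" "P = outline F"
proof -
  have sub: "P \<subseteq> grid_edges n" using assms by (rule pseudocycle_subset)
  have even_at: "even (of_bool (hedge x y \<in> P) + of_bool (hedge (x - 1) y \<in> P) +
    of_bool (vedge x y \<in> P) + of_bool (vedge x (y - 1) \<in> P) :: nat)" for x y
    using pseudocycle_even_degree[OF assms, of "(x, y)"] grid_degree[OF sub, of x y] by simp
  define F where "F x y \<longleftrightarrow> odd (card {u \<in> {1..y}. hedge x u \<in> P})" for x y
  have out: "\<not> F x y" if "y < 1 \<or> x < 1 \<or> int n \<le> x" for x y
  proof -
    have "{u \<in> {1..y}. hedge x u \<in> P} = {}" using that sub by (auto simp: hedge_grid_iff dest!: subsetD)
    then show ?thesis by (simp only: F_def) simp
  qed
  have hor: "hedge x y \<in> P \<longleftrightarrow> F x y \<noteq> F x (y - 1)" for x y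
  proof (cases "y < 1")
    case True
    then show ?thesis using out[of y x] out[of "y - 1" x] sub by (auto simp: hedge_grid_iff dest!: subsetD)
  next
    case False
    then have "{1..y} = insert y {1..y - 1}" by auto
    then have "{u \<in> {1..y}. hedge x u \<in> P} =
      (if hedge x y \<in> P then insert y {u \<in> {1..y - 1}. hedge x u \<in> P} else {u \<in> {1..y - 1}. hedge x u \<in> P})"
      by auto
    moreover have "finite {u \<in> {1..y - 1}. hedge x u \<in> P}" by (rule finite_Collect_conjI) simp
    moreover have "y \<notin> {u \<in> {1..y - 1}. hedge x u \<in> P}" by simp
    ultimately show ?thesis
      by (cases "hedge x y \<in> P") (simp_all only: F_def card_insert_disjoint even_Suc if_True if_False simp_thms)
  qed
  \<comment> \<open>Going up, the even degree at the vertex between two consecutive vertical edges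
    transfers the claim from the lower to the upper one.\<close>
  have ver_nat: "vedge x (int k) \<in> P \<longleftrightarrow> F x (int k) \<noteq> F (x - 1) (int k)" for x k
  proof (induction k)
    case 0
    then show ?case using out[of 0 x] out[of 0 "x - 1"] sub by (auto simp: vedge_grid_iff dest!: subsetD)
  next
    case (Suc k)
    then show ?case
      using even_at[of x "int (Suc k)"] hor[of x "int (Suc k)"] hor[of "x - 1" "int (Suc k)"]
      by (auto split: if_splits)
  qed
  have ver: "vedge x y \<in> P \<longleftrightarrow> F x y \<noteq> F (x - 1) y" for x y
  proof (cases "y < 0")
    case True
    then show ?thesis using out[of y x] out[of y "x - 1"] sub by (auto simp: vedge_grid_iff dest!: subsetD)
  next
    case False
    then show ?thesis using ver_nat[of x "nat y"] by simp
  qed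
  \<comment> \<open>Counting from below does not by itself make \<open>F\<close> empty above the
    grid. But no vertical edges lie there, so the emptiness of column 0 spreads to the
    right.\<close>
  have top: "\<not> F (int k) y" if "int n \<le> y" for k y
  proof (induction k)
    case 0 then show ?case using out by simp
  next
    case (Suc k)
    have "vedge (int (Suc k)) y \<notin> P" using that sub by (auto simp: vedge_grid_iff dest!: subsetD)
    then show ?case using ver[of "int (Suc k)" y] Suc by simp
  qed
  have "region n F"
    unfolding region_def
  proof (intro allI impI)
    fix x y assume F: "F x y"
    then have "1 \<le> x" "x < int n" "1 \<le> y" using out[of y x] by force+
    moreover from this have "y < int n" using top[of y "nat x"] F by force
    ultimately show "(x, y) \<in> grid_cells n" by (simp add: grid_cells_def)
  qed
  moreover have "P = outline F"
  proof (intro equalityI subsetI)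
    fix e assume e: "e \<in> P"
    then obtain x y where "e = hedge x y \<or> e = vedge x y"
      using sub unfolding grid_edges_eq by blast
    then show "e \<in> outline F" using e hor ver hedge_outline_iff vedge_outline_iff by metis
  next
    fix e assume e: "e \<in> outline F"
    then obtain x y where "e = hedge x y \<or> e = vedge x y" unfolding outline_def by blast
    then show "e \<in> P" using e hor ver hedge_outline_iff vedge_outline_iff by metis
  qed
  ultimately show thesis using that by blast
qed

text \<open>The degree of a vertex is the number of changes of \<open>F\<close> around its four
  cells, hence even; it is 4 only for a checkerboard, which \<open>check\<close> rules out.\<close>

lemma pseudocycle_outlineI:
  assumes F: "region n F" and ne: "F a b"
    and check: "\<And>x y. F x y = F (x - 1) (y - 1) \<Longrightarrow> F x (y - 1) = F (x - 1) y \<Longrightarrow> F x y = F x (y - 1)"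
  shows "pseudocycle (grid_edges n) (outline F)"
proof (rule pseudocycle_if_degree_0_2)
  show sub: "outline F \<subseteq> grid_edges n" using F by (rule outline_subset)
  then show "finite (outline F)" using finite_grid_edges finite_subset by blast
  show "outline F \<noteq> {}"
  proof
    assume "outline F = {}"
    moreover have "region n (\<lambda>x y. False)" "outline (\<lambda>x y. False) = {}"
      by (auto simp: region_def outline_def)
    ultimately have "F = (\<lambda>x y. False)" using outline_eqD[OF F] by metis
    then show False using ne by simp
  qed
  show "card {e \<in> outline F. v \<in> e} \<in> {0, 2}" for v
  proof -
    obtain x y where v: "v = (x, y)" by (cases v)
    show ?thesis using check[of x y] unfolding v grid_degree[OF sub] hedge_outline_iff vedge_outline_iff
      by (auto split: if_splits)
  qed
qed (rule card_grid_edge)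

section \<open>Signatures of outlines, computed from the cells\<close>

definition border_count :: "(int \<Rightarrow> int \<Rightarrow> bool) \<Rightarrow> int \<Rightarrow> int \<Rightarrow> nat" where
  "border_count F x y = of_bool (F x y \<noteq> F x (y - 1)) + of_bool (F x y \<noteq> F x (y + 1)) +
     of_bool (F x y \<noteq> F (x - 1) y) + of_bool (F x y \<noteq> F (x + 1) y)"

lemma card_cell_edges_outline: "card (cell_edges (x, y) \<inter> outline F) = border_count F x y"
proof -
  have "cell_edges (x, y) = {hedge x y, hedge x (y + 1), vedge x y, vedge (x + 1) y}"
    by (simp add: hedge_def vedge_def)
  then show ?thesis
    by (simp only:) (subst card_Int_4, auto simp: hedge_outline_iff vedge_outline_iff border_count_def)
qed

lemma pseudosignature_outline_eq_iff:
  "pseudosignature n (outline F) = pseudosignature n (outline G) \<longleftrightarrow>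
     (\<forall>x y. 1 \<le> x \<and> x < int n \<and> 1 \<le> y \<and> y < int n \<longrightarrow> border_count F x y = border_count G x y)"
proof -
  have eq: "pseudosignature n (outline H) (x, y) =
    (if 1 \<le> x \<and> x < int n \<and> 1 \<le> y \<and> y < int n then border_count H x y else undefined)" for H x y
    by (simp add: pseudosignature_def grid_cells_def card_cell_edges_outline del: cell_edges.simps)
  have "((if c then p else u) = (if c then q else u)) = (c \<longrightarrow> p = q)" for c and p q u :: nat
    by simp
  then show ?thesis by (simp only: fun_eq_iff split_paired_All eq)
qed

section \<open>Combs with a flipped rectangle\<close>

text \<open>Row 0 is empty and row 1 is common. Once two consecutive rows are known, the count at a
  cell of the upper one leaves a single choice for the neighbour above it.\<close>

lemma region_eqI:
  assumes F: "region n F" and G: "region n G"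
    and count: "\<And>x y. 1 \<le> x \<Longrightarrow> x < int n \<Longrightarrow> 1 \<le> y \<Longrightarrow> y < int n \<Longrightarrow>
      border_count F x y = border_count G x y"
    and row: "\<And>x. F x 1 = G x 1"
  shows "F = G"
proof -
  note out = region_outside[OF F] region_outside[OF G]
  have rows: "\<forall>x. F x (int k) = G x (int k) \<and> F x (int k + 1) = G x (int k + 1)" for k
  proof (induction k)
    case 0
    then show ?case using out row by simp
  next
    case (Suc k)
    have "F x (int k + 2) = G x (int k + 2)" for x
    proof (cases "1 \<le> x \<and> x < int n \<and> int k + 1 < int n")
      case True
      then have "border_count F x (int k + 1) = border_count G x (int k + 1)"
        by (intro count) auto
      moreover have "F x (int k) = G x (int k)" "F a (int k + 1) = G a (int k + 1)" for a
        using Suc by blast+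
      ultimately show ?thesis
        by (cases "G x (int k + 1)"; cases "F x (int k + 2)"; cases "G x (int k + 2)") (simp_all add: border_count_def add.assoc split: if_splits)
    next
      case False
      then show ?thesis using out[of x "int k + 2"] by auto
    qed
    then show ?case using Suc by (simp add: add.commute add.left_commute)
  qed
  have "F x y = G x y" for x y
  proof (cases "y < 0")
    case True
    then show ?thesis using out by simp
  next
    case False
    then show ?thesis using rows[of "nat y"] by simp
  qed
  then show ?thesis by blast
qed

text \<open>The value of the cell itself enters four times and cancels modulo 2. The condition is
  affine over the two-element field, so the difference of two solutions satisfies the homogeneous
  version.\<close>

lemma even_border_count:
  "even (border_count F x y) \<longleftrightarrow> (F x (y - 1) = F x (y + 1)) = (F (x - 1) y = F (x + 1) y)"
  by (simp add: border_count_def)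

text \<open>From \<open>G\<close> to \<open>F\<close>, vertical neighbours can only change away from
  \<open>b\<close> and horizontal ones only towards \<open>b\<close>. As the cell itself is fixed,
  the two kinds move the count by one in opposite directions.\<close>

lemma border_count_eq_iff_balanced:
  assumes "F x y = G x y"
    and "F x (y - 1) \<noteq> G x (y - 1) \<Longrightarrow> G x (y - 1) = b"
    and "F x (y + 1) \<noteq> G x (y + 1) \<Longrightarrow> G x (y + 1) = b"
    and "F (x - 1) y \<noteq> G (x - 1) y \<Longrightarrow> G (x - 1) y \<noteq> b"
    and "F (x + 1) y \<noteq> G (x + 1) y \<Longrightarrow> G (x + 1) y \<noteq> b"
  shows "border_count F x y = border_count G x y \<longleftrightarrow>
    (of_bool (F x (y - 1) \<noteq> G x (y - 1)) + of_bool (F x (y + 1) \<noteq> G x (y + 1)) :: int) =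
    of_bool (F (x - 1) y \<noteq> G (x - 1) y) + of_bool (F (x + 1) y \<noteq> G (x + 1) y)"
proof -
  have "F x (y - 1) = G x (y - 1) \<or> F x (y - 1) = (\<not> b) \<and> G x (y - 1) = b"
    "F x (y + 1) = G x (y + 1) \<or> F x (y + 1) = (\<not> b) \<and> G x (y + 1) = b"
    "F (x - 1) y = G (x - 1) y \<or> F (x - 1) y = b \<and> G (x - 1) y = (\<not> b)"
    "F (x + 1) y = G (x + 1) y \<or> F (x + 1) y = b \<and> G (x + 1) y = (\<not> b)"
    using assms(2-5) by (cases b; auto)+
  then show ?thesis
    unfolding border_count_def assms(1)
    by (elim disjE conjE; cases b; cases "G x y"; simp)
qed

section \<open>The flipped combs: equal signatures and no checkerboards\<close>

definition comb :: "int \<Rightarrow> int \<Rightarrow> int \<Rightarrow> int \<Rightarrow> bool" where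
  "comb m t x y \<longleftrightarrow> 1 \<le> x \<and> x \<le> 2 * m + 1 \<and> 1 \<le> y \<and> y \<le> 2 * m + 1 \<and> odd x \<and> (y = 1 \<longrightarrow> 2 * t < x)"

text \<open>Also empty for \<open>j = 0\<close>, so that the comb itself is the case \<open>j = 0\<close> of \<open>flipped_comb\<close>.\<close>

definition tilted_rect :: "int \<Rightarrow> int \<Rightarrow> int \<Rightarrow> int \<Rightarrow> bool" where
  "tilted_rect m j x y \<longleftrightarrow> odd (x + y) \<and> \<bar>x - y\<bar> < j \<and> \<bar>x + y - (2 * m + 2)\<bar> < 2 * m + 2 - j"

definition flipped_comb :: "int \<Rightarrow> int \<Rightarrow> int \<Rightarrow> int \<Rightarrow> int \<Rightarrow> bool" where
  "flipped_comb m t j x y \<longleftrightarrow> comb m t x y \<noteq> tilted_rect m j x y"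

definition corners :: "nat \<Rightarrow> nat \<Rightarrow> int set" where
  "corners m t = insert 0 ((\<lambda>i. 2 * int i) ` {t + 1..m})"

lemma cornersD:
  "j \<in> corners m t \<Longrightarrow> even j \<and> (j = 0 \<or> 2 * int t + 2 \<le> j \<and> j \<le> 2 * int m)"
  by (auto simp: corners_def)

lemma card_corners: "t \<le> m \<Longrightarrow> card (corners m t) = m - t + 1"
  by (auto simp: corners_def card_insert_if card_image inj_on_def)

lemma tilted_rect_bounds:
  "tilted_rect m j x y \<Longrightarrow> 1 \<le> x \<and> x \<le> 2 * m + 1 \<and> 1 \<le> y \<and> y \<le> 2 * m + 1 \<and> j < x + y \<and> x < y + j"
  unfolding tilted_rect_def by linarith

lemma region_flipped_comb: "region (2 * m + 2) (flipped_comb (int m) t j)"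
  unfolding region_def flipped_comb_def
  using tilted_rect_bounds[of "int m" j] by (fastforce simp: comb_def grid_cells_def)

text \<open>In the coordinates \<open>x - y\<close> and \<open>x + y\<close> the rectangle is a
  product of two intervals, so the claim reads AP + BQ = BP + AQ, that is (A - B)(P - Q) = 0. This
  could fail only at (j, 0), (0, j), (2m+2, 2m+2-j) and (2m+2-j, 2m+2), all off the board.\<close>

lemma tilted_rect_balanced:
  assumes "even j" "even (x + y)" "1 \<le> x" "x \<le> 2 * m + 1" "1 \<le> y" "y \<le> 2 * m + 1"
  shows "(of_bool (tilted_rect m j x (y - 1)) + of_bool (tilted_rect m j x (y + 1)) :: int) =
    of_bool (tilted_rect m j (x - 1) y) + of_bool (tilted_rect m j (x + 1) y)"
proof -
  define A B P Q where "A \<longleftrightarrow> \<bar>x - y + 1\<bar> < j" and "B \<longleftrightarrow> \<bar>x - y - 1\<bar> < j"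
    and "P \<longleftrightarrow> \<bar>x + y - 1 - (2 * m + 2)\<bar> < 2 * m + 2 - j"
    and "Q \<longleftrightarrow> \<bar>x + y + 1 - (2 * m + 2)\<bar> < 2 * m + 2 - j"
  have eqs: "tilted_rect m j x (y - 1) \<longleftrightarrow> A \<and> P" "tilted_rect m j x (y + 1) \<longleftrightarrow> B \<and> Q"
    "tilted_rect m j (x - 1) y \<longleftrightarrow> B \<and> P" "tilted_rect m j (x + 1) y \<longleftrightarrow> A \<and> Q"
    using assms(2) by (auto simp: tilted_rect_def A_def B_def P_def Q_def algebra_simps)
  have "A = B \<or> P = Q"
  proof (rule ccontr)
    assume neq: "\<not> (A = B \<or> P = Q)"
    obtain v where v: "x + y = 2 * v" using assms(2) by (elim evenE)
    obtain j' where j': "j = 2 * j'" using assms(1) by (elim evenE)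
    have "A \<longleftrightarrow> - j' \<le> v - y \<and> v - y < j'" "B \<longleftrightarrow> - j' < v - y \<and> v - y \<le> j'"
      using v j' unfolding A_def B_def by linarith+
    then have "x - y = j \<or> y - x = j" using neq v j' by linarith
    moreover have "P \<longleftrightarrow> j' < v \<and> v \<le> 2 * m + 2 - j'" "Q \<longleftrightarrow> j' \<le> v \<and> v < 2 * m + 2 - j'"
      using v j' unfolding P_def Q_def by linarith+
    then have "x + y = j \<or> x + y = 4 * m + 4 - j" using neq v j' by linarith
    ultimately show False using assms(3-) by linarith
  qed
  then show ?thesis unfolding eqs by auto
qed

text \<open>Where \<open>x + y\<close> is even, the cell is unchanged and its changed neighbours
  balance. Where \<open>x + y\<close> is odd, no neighbour changes, and a flipped cell has exactly
  two full neighbours, so its count is 2 before and after.\<close>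

lemma border_count_flipped_comb:
  assumes j: "j \<in> corners m t" and cell: "1 \<le> x" "x \<le> 2 * int m + 1" "1 \<le> y" "y \<le> 2 * int m + 1"
  shows "border_count (flipped_comb (int m) (int t) j) x y = border_count (comb (int m) (int t)) x y"
proof (cases "even (x + y)")
  case True
  let ?F = "flipped_comb (int m) (int t) j" and ?G = "comb (int m) (int t)"
  have G: "?G a b = odd a" if "tilted_rect (int m) j a b" for a b
    using tilted_rect_bounds[OF that] that by (cases "b = 1") (auto simp: comb_def tilted_rect_def)
  have diff: "?F a b \<noteq> ?G a b \<longleftrightarrow> tilted_rect (int m) j a b" for a b
    by (auto simp: flipped_comb_def)
  have G': "?G a b = odd a" if "?F a b \<noteq> ?G a b" for a b using that unfolding diff by (rule G)
  have same: "?F x y = ?G x y" using True by (simp add: flipped_comb_def tilted_rect_def)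
  have "border_count ?F x y = border_count ?G x y \<longleftrightarrow>
    (of_bool (?F x (y - 1) \<noteq> ?G x (y - 1)) + of_bool (?F x (y + 1) \<noteq> ?G x (y + 1)) :: int) =
    of_bool (?F (x - 1) y \<noteq> ?G (x - 1) y) + of_bool (?F (x + 1) y \<noteq> ?G (x + 1) y)"
    by (rule border_count_eq_iff_balanced[of ?F x y ?G "odd x", OF same]; drule G'; simp)
  then show ?thesis
    unfolding diff using tilted_rect_balanced[of j x y "int m"] cornersD[OF j] True cell by blast
next
  case False
  have nb: "\<not> tilted_rect (int m) j x (y - 1)" "\<not> tilted_rect (int m) j x (y + 1)"
    "\<not> tilted_rect (int m) j (x - 1) y" "\<not> tilted_rect (int m) j (x + 1) y"
    using False by (auto simp: tilted_rect_def)
  show ?thesis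
  proof (cases "tilted_rect (int m) j x y")
    case True
    have b: "1 \<le> x \<and> x \<le> 2 * int m + 1 \<and> 1 \<le> y \<and> y \<le> 2 * int m + 1 \<and> j < x + y"
      "even j" "2 * int t + 2 \<le> j"
      using tilted_rect_bounds[OF True] cornersD[OF j] True by (auto simp: tilted_rect_def)
    let ?G = "comb (int m) (int t)"
    \<comment> \<open>A cell of the rectangle in an odd column has even \<open>y\<close>, so its
      vertical neighbours are on the board; in an even column the horizontal ones are. By
      \<open>j < x + y\<close> and \<open>2 * int t + 2 \<le> j\<close> they avoid the removed
      cells.\<close>
    have "2 \<le> y \<and> y \<le> 2 * int m" if "odd x"
      using b(1) False that by (cases "y = 1"; cases "y = 2 * int m + 1") auto
    moreover have "2 \<le> x \<and> x \<le> 2 * int m" if "even x"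
      using b(1) that by (cases "x = 1"; cases "x = 2 * int m + 1") auto
    ultimately have "?G x (y - 1) = odd x \<and> ?G x (y + 1) = odd x \<and> ?G (x - 1) y = even x \<and> ?G (x + 1) y = even x"
      using b False by (cases "odd x") (auto simp: comb_def)
    then show ?thesis using nb by (simp add: border_count_def flipped_comb_def)
  next
    case no: False
    then show ?thesis using nb by (simp add: border_count_def flipped_comb_def)
  qed
qed

text \<open>One diagonal of each block consists of unflipped cells with \<open>x + y\<close> even.
  They lie in adjacent columns, so the comb separates them, unless the block touches a removed
  cell.\<close>

lemma flipped_comb_no_checkerboard:
  assumes j: "j \<in> corners m t"
    and "flipped_comb (int m) (int t) j x y = flipped_comb (int m) (int t) j (x - 1) (y - 1)"
    and "flipped_comb (int m) (int t) j x (y - 1) = flipped_comb (int m) (int t) j (x - 1) y"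
  shows "flipped_comb (int m) (int t) j x y = flipped_comb (int m) (int t) j x (y - 1)"
proof -
  let ?F = "flipped_comb (int m) (int t) j" and ?G = "comb (int m) (int t)" and ?R = "tilted_rect (int m) j"
  have out: "\<not> ?F a b" if "\<not> (1 \<le> a \<and> a \<le> 2 * int m + 1 \<and> 1 \<le> b \<and> b \<le> 2 * int m + 1)" for a b
    using region_outside[OF region_flipped_comb[of m "int t" j], of a b] that by auto
  show ?thesis
  proof (cases "2 \<le> x \<and> x \<le> 2 * int m + 1 \<and> 2 \<le> y \<and> y \<le> 2 * int m + 1")
    case False
    then consider "x \<le> 1" | "2 * int m + 1 < x" | "y \<le> 1" | "2 * int m + 1 < y" by linarith
    then show ?thesis
      by cases (use assms(2,3) out in force)+
  next
    case box: True
    have even_class: "?F a b = ?G a b" if "even (a + b)" for a b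
      using that by (simp add: flipped_comb_def tilted_rect_def)
    show ?thesis
    proof (cases "y = 2")
      case False
      then have "?G x y \<noteq> ?G (x - 1) (y - 1)" "?G x (y - 1) \<noteq> ?G (x - 1) y"
        using box by (auto simp: comb_def)
      then show ?thesis
        using assms(2,3) even_class[of x y] even_class[of "x - 1" "y - 1"]
          even_class[of x "y - 1"] even_class[of "x - 1" y] by (cases "even (x + y)") auto
    next
      case y: True
      \<comment> \<open>Over the removed cells both lower cells of the block are empty, whereas a
        checkerboard has a full cell in each row.\<close>
      have notch: "\<not> ?R a 1" if "a \<le> 2 * int t + 1" for a
        using tilted_rect_bounds[of "int m" j a 1] cornersD[OF j] that
        by (auto simp: tilted_rect_def)
      show ?thesis
      proof (cases "odd x")
        case True
        then have "?F x 1 = ?G x 1" "?F (x - 1) 2 = ?G (x - 1) 2"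
          by (simp_all add: even_class)
        moreover have "\<not> ?F (x - 1) 1" if "x \<le> 2 * int t"
          using that notch[of "x - 1"] True by (simp add: flipped_comb_def comb_def)
        ultimately show ?thesis
          using assms(2,3) box True y by (cases "2 * int t < x") (auto simp: comb_def)
      next
        case False
        then have "?F x 2 = ?G x 2" "?F (x - 1) 1 = ?G (x - 1) 1"
          by (simp_all add: even_class)
        moreover have "\<not> ?F x 1" if "x - 1 \<le> 2 * int t"
          using that notch[of x] False by (simp add: flipped_comb_def comb_def)
        ultimately show ?thesis
          using assms(2,3) box False y by (cases "2 * int t < x - 1") (auto simp: comb_def)
      qed
    qed
  qed
qed

lemma tilted_rect_row_1:
  assumes "j \<in> corners m t" "1 \<le> x"
  shows "tilted_rect (int m) j x 1 \<longleftrightarrow> x = j"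
proof
  assume "tilted_rect (int m) j x 1"
  then show "x = j" using tilted_rect_bounds[of "int m" j x 1] by linarith
next
  assume "x = j"
  then show "tilted_rect (int m) j x 1"
    using cornersD[OF assms(1)] assms(2) by (auto simp: tilted_rect_def)
qed

lemma flipped_comb_inj_on: "inj_on (flipped_comb (int m) (int t)) (corners m t)"
proof (rule inj_onI)
  fix i j assume ij: "i \<in> corners m t" "j \<in> corners m t"
    and "flipped_comb (int m) (int t) i = flipped_comb (int m) (int t) j"
  then have "tilted_rect (int m) i x 1 = tilted_rect (int m) j x 1" for x
    unfolding flipped_comb_def fun_eq_iff by blast
  then have "x = i \<longleftrightarrow> x = j" if "1 \<le> x" for x
    using tilted_rect_row_1[OF ij(1) that] tilted_rect_row_1[OF ij(2) that] by blast
  from this[of i] this[of j] show "i = j"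
    using cornersD[OF ij(1)] cornersD[OF ij(2)] by (cases "1 \<le> i"; cases "1 \<le> j") auto
qed

section \<open>Every solution is a flipped comb\<close>

lemma flipped_comb_if_border_count_eq:
  assumes F: "region (2 * m + 2) F" and "1 \<le> m" "t \<le> m"
    and count: "\<And>x y. 1 \<le> x \<Longrightarrow> x \<le> 2 * int m + 1 \<Longrightarrow> 1 \<le> y \<Longrightarrow> y \<le> 2 * int m + 1 \<Longrightarrow>
      border_count F x y = border_count (comb (int m) (int t)) x y"
  obtains j where "j \<in> corners m t" "F = flipped_comb (int m) (int t) j"
proof -
  define G where "G = comb (int m) (int t)"
  define D where "D x y \<longleftrightarrow> F x y \<noteq> G x y" for x y
  define K where "K = 2 * int m + 1"
  have K: "odd K" "3 \<le> K" using \<open>1 \<le> m\<close> by (auto simp: K_def)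
  have G_iff: "G x y \<longleftrightarrow> 1 \<le> x \<and> x \<le> K \<and> 1 \<le> y \<and> y \<le> K \<and> odd x \<and> (y = 1 \<longrightarrow> 2 * int t < x)" for x y
    by (auto simp: G_def comb_def K_def)
  have F_out: "\<not> F x y" if "x < 1 \<or> K < x \<or> y < 1 \<or> K < y" for x y
    using region_outside[OF F, of x y] that by (auto simp: K_def)
  have D_out: "\<not> D x y" if "x < 1 \<or> K < x \<or> y < 1 \<or> K < y" for x y
    using F_out[OF that] that by (auto simp: D_def G_iff)
  have count: "border_count F x y = border_count G x y" if "1 \<le> x" "x \<le> K" "1 \<le> y" "y \<le> K" for x y
    using count that by (simp add: K_def G_def)

  have parity: "(D x (y - 1) = D x (y + 1)) = (D (x - 1) y = D (x + 1) y)"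
    if "1 \<le> x" "x \<le> K" "1 \<le> y" "y \<le> K" for x y
  proof -
    have "((F x (y - 1) = F x (y + 1)) = (F (x - 1) y = F (x + 1) y)) =
      ((G x (y - 1) = G x (y + 1)) = (G (x - 1) y = G (x + 1) y))"
      using count[OF that] even_border_count[of F x y] even_border_count[of G x y] by simp
    then show ?thesis
      unfolding D_def
      by (cases "F x (y - 1)"; cases "F x (y + 1)"; cases "F (x - 1) y"; cases "F (x + 1) y") auto
  qed
  \<comment> \<open>The sum of \<open>D\<close> over \<open>(x, y + 1)\<close> and \<open>(x - 1, y)\<close> is invariant under \<open>(x, y) \<mapsto> (x + 1, y - 1)\<close>.\<close>
  have sum_parity: "D x (int k + 1) = (D (x - 1) (int k) \<noteq> D (x + int k) 1)"
    if "1 \<le> x" "x + int k \<le> K" for x k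
    using that
  proof (induction k arbitrary: x)
    case 0
    then show ?case using D_out by simp
  next
    case (Suc k)
    have "D (x + 1) (int k + 1) = (D x (int k) \<noteq> D (x + int k + 1) 1)"
      using Suc.IH[of "x + 1"] Suc.prems by (simp add: algebra_simps)
    moreover have "(D x (int k) = D x (int k + 2)) = (D (x - 1) (int k + 1) = D (x + 1) (int k + 1))"
      using parity[of x "int k + 1"] Suc.prems by (simp add: algebra_simps)
    moreover have "int (Suc k) + 1 = int k + 2" "x + int (Suc k) = x + int k + 1" "int (Suc k) = int k + 1"
      by simp_all
    ultimately show ?case by (simp only:) blast
  qed
  \<comment> \<open>The case \<open>x = 1\<close> of \<open>sum_parity\<close>: the term in column 0
    vanishes.\<close>
  have column_row: "D 1 y = D y 1" if "1 \<le> y" "y \<le> K" for y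
    using sum_parity[of 1 "nat (y - 1)"] that D_out by (simp add: algebra_simps)

  have count1: "border_count F x 1 = border_count G x 1" "\<not> F x 0" "\<not> G x 0"
    if "1 \<le> x" "x \<le> K" for x
    using count[of x 1] F_out[of 0 x] F_out[of x 0] that K by (auto simp: G_iff)
  \<comment> \<open>The comb has count 0 here, but a full cell would have its bottom edge on the
    outline.\<close>
  have even_notch: "\<not> D x 1" if x: "even x" "1 \<le> x" "x < 2 * int t" for x
  proof -
    have "x \<le> K" using x(3) \<open>t \<le> m\<close> by (simp add: K_def)
    have "\<not> G x 1" "\<not> G (x - 1) 1" "\<not> G (x + 1) 1" "\<not> G x 2"
      using x by (auto simp: G_iff)
    then show ?thesis
      using count1[OF x(2) \<open>x \<le> K\<close>] by (auto simp: border_count_def D_def)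
  qed
  \<comment> \<open>The count is 1, due to the full cell above. If the cell were full, its bottom
    edge would account for that, so its left neighbour would be full too, against
    \<open>even_notch\<close> or the border.\<close>
  have odd_notch: "\<not> D x 1" if x: "odd x" "1 \<le> x" "x < 2 * int t" for x
  proof
    assume D: "D x 1"
    have "x \<le> K" using x(3) \<open>t \<le> m\<close> by (simp add: K_def)
    have G: "\<not> G x 1" "\<not> G (x - 1) 1" "\<not> G (x + 1) 1" "G x 2"
      using x K \<open>x \<le> K\<close> by (auto simp: G_iff)
    then have "F (x - 1) 1"
      using count1[OF x(2) \<open>x \<le> K\<close>] D by (auto simp: border_count_def D_def split: if_splits)
    then have "D (x - 1) 1" "1 \<le> x - 1" using G F_out[of "x - 1" 1] by (force simp: D_def)+
    then show False using even_notch[of "x - 1"] x by simp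
  qed
  \<comment> \<open>Here the count 1 comes from the tooth on the right; the left neighbour again
    would have to be full, against \<open>odd_notch\<close>.\<close>
  have last_notch: "\<not> D (2 * int t) 1"
  proof
    assume D: "D (2 * int t) 1"
    then have t: "1 \<le> 2 * int t" "2 * int t \<le> K" using D_out[of "2 * int t" 1] by force+
    have G: "\<not> G (2 * int t) 1" "\<not> G (2 * int t - 1) 1" "G (2 * int t + 1) 1" "\<not> G (2 * int t) 2"
      using t K \<open>t \<le> m\<close> by (auto simp: G_iff K_def)
    then have "F (2 * int t - 1) 1"
      using count1[OF t] D by (auto simp: border_count_def D_def split: if_splits)
    then have "D (2 * int t - 1) 1" using G by (simp add: D_def)
    moreover have "1 \<le> 2 * int t - 1" using t(1) by presburger
    ultimately show False using odd_notch[of "2 * int t - 1"] by simp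
  qed
  \<comment> \<open>The comb has count 3, so emptying the tooth forces both horizontal neighbours to
    be full in \<open>F\<close>. Symmetry then empties three consecutive cells of column 1, and the
    middle one has count at most 1 instead of 2.\<close>
  have odd_tooth: "\<not> D x 1" if x: "odd x" "2 * int t < x" for x
  proof
    assume D: "D x 1"
    then have b: "1 \<le> x" "x \<le> K" using D_out[of x 1] by force+
    have G: "G x 1" "\<not> G (x - 1) 1" "\<not> G (x + 1) 1" "G x 2"
      using x K b by (auto simp: G_iff)
    then have F: "F (x - 1) 1" "F (x + 1) 1"
      using count1[OF b] D
      by (cases "F x 2"; cases "F (x - 1) 1"; cases "F (x + 1) 1"; simp add: border_count_def D_def)+
    then have b': "1 \<le> x - 1" "x + 1 \<le> K" using F_out[of "x - 1" 1] F_out[of "x + 1" 1] by force+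
    have "D (x - 1) 1" "D (x + 1) 1" using F G by (auto simp: D_def)
    then have "D 1 (x - 1)" "D 1 x" "D 1 (x + 1)"
      using column_row[of "x - 1"] column_row[of x] column_row[of "x + 1"] D b b' by auto
    moreover have "G 1 (x - 1)" "G 1 x" "G 1 (x + 1)"
    proof -
      \<comment> \<open>The cell (1, 1), possibly removed from the comb, is thus not among the
        three.\<close>
      have "x - 1 \<noteq> 1" using x(1) by auto
      then show "G 1 (x - 1)" "G 1 x" "G 1 (x + 1)" using b b' K by (auto simp: G_iff)
    qed
    moreover have "border_count F 1 x = border_count G 1 x" using count[of 1 x] b K by simp
    moreover have "\<not> F 0 x" "\<not> G 0 x" "\<not> G 2 x" using F_out[of 0 x] by (auto simp: G_iff)
    ultimately show False
      by (cases "F 2 x"; simp add: border_count_def D_def)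
  qed
  have odd_row: "\<not> D x 1" if "odd x" for x
    using odd_notch[OF that] odd_tooth[OF that] last_notch D_out[of x 1]
    by (cases "1 \<le> x"; cases "x < 2 * int t"; cases "x = 2 * int t") auto
  have notch_row: "\<not> D x 1" if "x \<le> 2 * int t" for x
    using odd_row[of x] even_notch[of x] last_notch D_out[of x 1] that
    by (cases "1 \<le> x"; cases "x = 2 * int t"; cases "odd x") auto

  \<comment> \<open>\<open>parity\<close> carries the emptiness of this class from rows 0 and 1 to
    all higher rows.\<close>
  have even_class_rows: "\<forall>x. (even (x + int k) \<longrightarrow> \<not> D x (int k)) \<and> (even (x + int k + 1) \<longrightarrow> \<not> D x (int k + 1))" for k
  proof (induction k)
    case 0
    then show ?case using D_out odd_row by auto
  next
    case (Suc k)
    have "\<not> D x (int k + 2)" if "even (x + int k)" for x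
    proof (cases "1 \<le> x \<and> x \<le> K \<and> int k + 1 \<le> K")
      case True
      have "\<not> D x (int k)" "\<not> D (x - 1) (int k + 1)" "\<not> D (x + 1) (int k + 1)"
        using Suc that by auto
      then show ?thesis using parity[of x "int k + 1"] True by (simp add: algebra_simps)
    next
      case False
      then show ?thesis using D_out[of x "int k + 2"] by auto
    qed
    then show ?case using Suc by (simp add: add.commute add.left_commute)
  qed
  have even_class: "\<not> D x y" if "even (x + y)" for x y
  proof (cases "y < 1")
    case True
    then show ?thesis using D_out by blast
  next
    case False
    then show ?thesis using even_class_rows[of "nat y"] that by simp
  qed

  define e where "e x y = (of_bool (D x y) :: int)" for x y
  have balanced: "e x (y - 1) + e x (y + 1) = e (x - 1) y + e (x + 1) y"
    if "even (x + y)" "1 \<le> x" "x \<le> K" "1 \<le> y" "y \<le> K" for x y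
  proof -
    have G: "G a b = odd a" if "F a b \<noteq> G a b" for a b
    proof -
      have "D a b" using that by (simp add: D_def)
      then have "odd (a + b)" "1 \<le> a" "a \<le> K" "1 \<le> b" "b \<le> K"
        using even_class[of a b] D_out[of a b] by force+
      then show ?thesis by (cases "b = 1") (auto simp: G_iff)
    qed
    have same: "F x y = G x y" using even_class[OF that(1)] by (simp add: D_def)
    have "border_count F x y = border_count G x y \<longleftrightarrow>
      (of_bool (F x (y - 1) \<noteq> G x (y - 1)) + of_bool (F x (y + 1) \<noteq> G x (y + 1)) :: int) =
      of_bool (F (x - 1) y \<noteq> G (x - 1) y) + of_bool (F (x + 1) y \<noteq> G (x + 1) y)"
      by (rule border_count_eq_iff_balanced[of F x y G "odd x", OF same]; drule G; simp)
    then show ?thesis using count that(2-) by (simp add: e_def D_def)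
  qed
  \<comment> \<open>The telescoping of \<open>sum_parity\<close>, now over the integers:
    \<open>balanced\<close> keeps \<open>e x (y + 1) - e (x - 1) y\<close> constant along
    antidiagonals.\<close>
  have sum_step: "e x (int k + 1) = e (x - 1) (int k) + e (x + int k) 1"
    if "1 \<le> x" "x + int k \<le> K" "even (x + int k)" for x k
    using that
  proof (induction k arbitrary: x)
    case 0
    then show ?case using D_out by (simp add: e_def)
  next
    case (Suc k)
    have "e (x + 1) (int k + 1) = e x (int k) + e (x + int k + 1) 1"
      using Suc.IH[of "x + 1"] Suc.prems by (simp add: algebra_simps)
    moreover have "e x (int k) + e x (int k + 2) = e (x - 1) (int k + 1) + e (x + 1) (int k + 1)"
      using balanced[of x "int k + 1"] Suc.prems by (simp add: algebra_simps)
    moreover have "int (Suc k) + 1 = int k + 2" "x + int (Suc k) = x + int k + 1" "int (Suc k) = int k + 1"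
      by simp_all
    ultimately show ?case by (simp only:)
  qed
  \<comment> \<open>Each diagonal step from (p, p + 1) to (p + 1, p + 2) adds the bottom cell at 2p
    + 2. The whole sum is the 0/1 value of a single cell.\<close>
  have centre: "e (int p) (int p + 1) = (\<Sum>i = 1..p. e (2 * int i) 1)" if "p \<le> m" for p
    using that
  proof (induction p)
    case 0
    then show ?case using D_out by (simp add: e_def)
  next
    case (Suc p)
    have "e (int (Suc p)) (int (Suc p) + 1) = e (int p) (int p + 1) + e (2 * int (Suc p)) 1"
      using sum_step[of "int (Suc p)" "Suc p"] Suc.prems by (simp add: K_def algebra_simps)
    then show ?case using Suc by simp
  qed
  have le_1: "(\<Sum>i = 1..m. e (2 * int i) 1) \<le> 1"
    unfolding centre[OF order_refl, symmetric] by (simp add: e_def)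
  have at_most_one: "x = x'" if xx': "D x 1" "D x' 1" for x x'
  proof (rule ccontr)
    assume neq: "x \<noteq> x'"
    have half: "\<exists>i\<in>{1..m}. u = 2 * int i" if "D u 1" for u
    proof -
      have "even u" "1 \<le> u" "u \<le> K" using odd_row[of u] D_out[of u 1] that by force+
      then show ?thesis by (intro bexI[of _ "nat (u div 2)"]) (auto simp: K_def)
    qed
    obtain i i' where i: "i \<in> {1..m}" "x = 2 * int i" "i' \<in> {1..m}" "x' = 2 * int i'"
      using half[OF xx'(1)] half[OF xx'(2)] by blast
    then have "(\<Sum>i\<in>{i, i'}. e (2 * int i) 1) \<le> (\<Sum>i = 1..m. e (2 * int i) 1)"
      by (intro sum_mono2) (auto simp: e_def)
    moreover have "(\<Sum>i\<in>{i, i'}. e (2 * int i) 1) = e x 1 + e x' 1" using neq i by auto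
    moreover have "e x 1 = 1" "e x' 1 = 1" using xx' by (simp_all add: e_def)
    ultimately show False using le_1 by linarith
  qed
  obtain j where j: "j \<in> corners m t" "\<And>x. 1 \<le> x \<Longrightarrow> D x 1 \<longleftrightarrow> x = j"
  proof (cases "\<exists>x. D x 1")
    case True
    then obtain x where x: "D x 1" by blast
    then have b: "even x" "2 * int t < x" "x \<le> K"
      using odd_row[of x] notch_row[of x] D_out[of x 1] by force+
    then have "x = 2 * int (nat (x div 2))" "nat (x div 2) \<in> {t + 1..m}" by (auto simp: K_def)
    then have "x \<in> corners m t" unfolding corners_def by blast
    then show ?thesis using that x at_most_one by blast
  next
    case False
    then show ?thesis using that[of 0] by (auto simp: corners_def)
  qed
  have "F = flipped_comb (int m) (int t) j"
  proof (rule region_eqI[OF F region_flipped_comb])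
    fix x y assume xy: "1 \<le> x" "x < int (2 * m + 2)" "1 \<le> y" "y < int (2 * m + 2)"
    then show "border_count F x y = border_count (flipped_comb (int m) (int t) j) x y"
      using count[of x y] border_count_flipped_comb[OF j(1), of x y] by (simp add: K_def G_def)
  next
    fix x
    show "F x 1 = flipped_comb (int m) (int t) j x 1"
    proof (cases "1 \<le> x")
      case True
      then show ?thesis
        using j(2)[OF True] tilted_rect_row_1[OF j(1) True]
        by (auto simp: D_def G_def flipped_comb_def)
    next
      case False
      then show ?thesis using F_out[of x 1] region_outside[OF region_flipped_comb[of m "int t" j], of x 1] by simp
    qed
  qed
  then show thesis using that j(1) by blast
qed

theorem theorem9:
  fixes s :: nat
  assumes "s > 0"
  shows "\<forall>n0 > 0. \<exists>n \<ge> n0. \<exists>C. pseudocycle (grid_edges n) C \<and>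
           card {D. satisfies n D (pseudosignature n C)} = s"
proof (intro allI impI)
  fix n0 :: nat assume "n0 > 0"
  \<comment> \<open>The difference \<open>m - t = s - 1\<close> fixes the number of solutions, while
    \<open>m \<ge> n0\<close> makes the grid large.\<close>
  define m t where "m = n0 + s" and "t = n0 + 1"
  have mt: "1 \<le> m" "t \<le> m" "m - t + 1 = s" using assms by (auto simp: m_def t_def)
  let ?n = "2 * m + 2" and ?S = "\<lambda>j. outline (flipped_comb (int m) (int t) j)"
  let ?C = "?S 0"
  have base: "flipped_comb (int m) (int t) 0 = comb (int m) (int t)" "0 \<in> corners m t"
    by (auto simp: fun_eq_iff flipped_comb_def tilted_rect_def corners_def)
  have pc: "pseudocycle (grid_edges ?n) (?S j)" if "j \<in> corners m t" for j
  proof (rule pseudocycle_outlineI[OF region_flipped_comb])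
    \<comment> \<open>This cell is full for every \<open>j\<close>: it lies in an odd column above
      the bottom row, and its coordinate sum is even, so it is never flipped.\<close>
    show "flipped_comb (int m) (int t) j (2 * int m + 1) (2 * int m + 1)"
      using mt by (auto simp: flipped_comb_def comb_def tilted_rect_def)
  qed (rule flipped_comb_no_checkerboard[OF that])
  have "{D. satisfies ?n D (pseudosignature ?n ?C)} = ?S ` corners m t"
  proof (intro equalityI subsetI)
    fix D assume "D \<in> {D. satisfies ?n D (pseudosignature ?n ?C)}"
    then have D: "pseudocycle (grid_edges ?n) D" "pseudosignature ?n D = pseudosignature ?n ?C"
      by (auto simp: satisfies_def)
    obtain F where F: "region ?n F" "D = outline F" using pseudocycle_outline[OF D(1)] .
    have "border_count F x y = border_count (comb (int m) (int t)) x y"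
      if "1 \<le> x" "x \<le> 2 * int m + 1" "1 \<le> y" "y \<le> 2 * int m + 1" for x y
      using D(2) that unfolding F(2) pseudosignature_outline_eq_iff base(1) by simp
    then obtain j where "j \<in> corners m t" "F = flipped_comb (int m) (int t) j"
      using flipped_comb_if_border_count_eq[OF F(1) mt(1,2)] by blast
    then show "D \<in> ?S ` corners m t" using F(2) by blast
  next
    fix D assume "D \<in> ?S ` corners m t"
    then obtain j where j: "j \<in> corners m t" "D = ?S j" by blast
    have "pseudosignature ?n (?S j) = pseudosignature ?n ?C"
      unfolding pseudosignature_outline_eq_iff base(1)
      using border_count_flipped_comb[OF j(1)] by simp
    then show "D \<in> {D. satisfies ?n D (pseudosignature ?n ?C)}"
      using pc[OF j(1)] j(2) by (simp add: satisfies_def)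
  qed
  moreover have "inj_on ?S (corners m t)"
    using flipped_comb_inj_on outline_eqD[OF region_flipped_comb region_flipped_comb]
    unfolding inj_on_def by blast
  ultimately have "card {D. satisfies ?n D (pseudosignature ?n ?C)} = s"
    using card_corners[OF mt(2)] mt(3) by (simp add: card_image)
  then show "\<exists>n\<ge>n0. \<exists>C. pseudocycle (grid_edges n) C \<and> card {D. satisfies n D (pseudosignature n C)} = s"
    using pc[OF base(2)] by (intro exI[of _ ?n]) (auto simp: m_def)
qed

end
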